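(* Let $\gamma>0$ be fixed and put $c=\lceil\gamma\rceil$. There is no online bin packing algorithm with migration factor $\gamma$ (even if only insertions of items occur, and regardless of its running time) whose asymptotic approximation (competitive) ratio is better than $1+\frac{1}{6c+5}$.
   Context: Bin packing: items $i$ have sizes $s(i)\in(0,1]$ and must be partitioned into bins of capacity $1$; $\mathrm{OPT}(J)$ denotes the minimum number of bins for an item set $J$. In the online model with repacking, items $i_1,i_2,\dots$ arrive one at a time; at time $t$ the algorithm must produce a packing of $I(t)=\{i_1,\dots,i_t\}$ extending the previous one, and it may move (repack) previously packed items. The algorithm has migration factor $\gamma$ if at every time $t$ the total size of the items whose bin assignment changes at time $t$ is at most $\gamma\cdot s(i_t)$. Writing $A(I(t))$ for the number of bins used by algorithm $A$ at time $t$, $A$ has asymptotic approximation ratio at most $\alpha$ if there is a function $f\in o(\mathrm{OPT})$ with $A(I(t))\le \alpha\,\mathrm{OPT}(I(t))+f(I(t))$ for all input sequences $I$ and all $t$; the asymptotic approximation ratio is the minimum such $\alpha$. *)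

theory Defs
  imports Complex_Main "HOL-Library.Landau_Symbols" "HOL-Library.Extended_Real"
begin

text \<open>
  An item sequence is given by the list of its sizes in order of arrival; the items themselves
  are the positions of the list. A packing sends every item to the label of its bin.
\<close>

definition item_sequence :: "real list \<Rightarrow> bool" where
  "item_sequence I \<longleftrightarrow> set I \<subseteq> {0<..1}"

definition is_packing :: "real list \<Rightarrow> (nat \<Rightarrow> nat) \<Rightarrow> bool" where
  "is_packing I p \<longleftrightarrow> (\<forall>b. (\<Sum>i | i < length I \<and> p i = b. I ! i) \<le> 1)"

definition bins_used :: "real list \<Rightarrow> (nat \<Rightarrow> nat) \<Rightarrow> nat" where
  "bins_used I p = card (p ` {..<length I})"

definition OPT :: "real list \<Rightarrow> nat" where
  "OPT I = (LEAST k. \<exists>p. is_packing I p \<and> bins_used I p = k)"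

text \<open>
  A deterministic online algorithm maps the sequence of items that have arrived so far to its
  current packing of them. The packings of successive prefixes are related only by the bound on
  the migration.
\<close>

type_synonym online_algorithm = "real list \<Rightarrow> nat \<Rightarrow> nat"

definition online_packing_algorithm :: "online_algorithm \<Rightarrow> bool" where
  "online_packing_algorithm A \<longleftrightarrow> (\<forall>I. item_sequence I \<longrightarrow> is_packing I (A I))"

text \<open>
  The arriving item has no earlier bin, so only the items that were already packed count.
\<close>

definition has_migration_factor :: "online_algorithm \<Rightarrow> real \<Rightarrow> bool" where
  "has_migration_factor A \<gamma> \<longleftrightarrow>
     (\<forall>I x. item_sequence (I @ [x]) \<longrightarrow>
        (\<Sum>i | i < length I \<and> A (I @ [x]) i \<noteq> A I i. I ! i) \<le> \<gamma> * x)"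

text \<open>
  The filter on item sequences along which the optimum tends to infinity.
\<close>

definition OPT_at_top :: "real list filter" where
  "OPT_at_top = inf (filtercomap OPT at_top) (principal {I. item_sequence I})"

definition asymptotic_ratio_at_most :: "online_algorithm \<Rightarrow> real \<Rightarrow> bool" where
  "asymptotic_ratio_at_most A \<alpha> \<longleftrightarrow>
     (\<exists>f :: real list \<Rightarrow> real. f \<in> o[OPT_at_top](\<lambda>I. real (OPT I)) \<and>
        (\<forall>I. item_sequence I \<longrightarrow> real (bins_used I (A I)) \<le> \<alpha> * real (OPT I) + f I))"

text \<open>
  The infimum is \<open>\<infinity>\<close> if no finite ratio is achieved.
\<close>

definition asymptotic_ratio :: "online_algorithm \<Rightarrow> ereal" where
  "asymptotic_ratio A = (INF \<alpha>\<in>{\<alpha>. asymptotic_ratio_at_most A \<alpha>}. ereal \<alpha>)"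

end

theory Submission
  imports Defs
begin

text \<open>
  In units of \<open>1/(4c+3)\<close>, let \<open>N\<close> big items of size \<open>2c+1\<close> arrive, followed by \<open>(c+1)N\<close> small
  items of size \<open>2\<close>. A big item is larger than \<open>c\<close> small ones, so the arrival of small items never
  moves a big one. The big items alone fit into \<open>N/2\<close> bins, hence a good algorithm must pair almost
  all of them; but a pair leaves no room for a small item, whereas the optimum for the whole
  sequence puts one big item and \<open>c+1\<close> small ones into each of \<open>N\<close> completely filled bins.
  Weighting big items by \<open>c\<close> and small items by \<open>1\<close>, a bin has weight at most \<open>2c+1\<close>, and at most
  \<open>2c\<close> if it contains a pair. So \<open>P\<close> pairs force \<open>N + P/(2c+1)\<close> bins. This even excludes every
  ratio below \<open>1 + 1/(4c+3)\<close>.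
\<close>

text \<open>Positions below \<open>N\<close> carry size \<open>b\<close>, the others size
  \<open>x\<close>, so the load of a bin depends only on two cardinalities. This reduces packing
  conditions to counting.\<close>

lemma sum_fibre_two_sizes:
  "(\<Sum>i | i < length (replicate N b @ replicate m x) \<and> p i = v.
      (replicate N b @ replicate m x) ! i) =
   b * real (card {i. i < N \<and> p i = v}) + x * real (card {i. N \<le> i \<and> i < N + m \<and> p i = v})"
proof -
  let ?I = "replicate N b @ replicate m x"
  let ?B = "{i. i < N \<and> p i = v}" and ?S = "{i. N \<le> i \<and> i < N + m \<and> p i = v}"
  have "{i. i < length ?I \<and> p i = v} = ?B \<union> ?S"
    by auto
  moreover have "sum ((!) ?I) (?B \<union> ?S) = sum ((!) ?I) ?B + sum ((!) ?I) ?S"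
    by (rule sum.union_disjoint) auto
  moreover have "sum ((!) ?I) ?B = (\<Sum>i\<in>?B. b)"
    by (rule sum.cong) (auto simp: nth_append)
  moreover have "sum ((!) ?I) ?S = (\<Sum>i\<in>?S. x)"
    by (rule sum.cong) (auto simp: nth_append)
  ultimately show ?thesis
    by simp
qed

lemma is_packing_two_sizes:
  "is_packing (replicate N b @ replicate m x) p \<longleftrightarrow>
   (\<forall>v. b * real (card {i. i < N \<and> p i = v}) +
        x * real (card {i. N \<le> i \<and> i < N + m \<and> p i = v}) \<le> 1)"
  unfolding is_packing_def sum_fibre_two_sizes ..

lemma OPT_le_bins_used:
  assumes "is_packing I p"
  shows "OPT I \<le> bins_used I p"
  unfolding OPT_def by (rule Least_le) (use assms in blast)

lemma sum_list_le_bins_used: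
  assumes "is_packing I p"
  shows "sum_list I \<le> real (bins_used I p)"
proof -
  have "sum_list I = (\<Sum>i\<in>{..<length I}. I ! i)"
    by (simp add: sum_list_sum_nth atLeast0LessThan)
  also have "\<dots> = (\<Sum>v\<in>p ` {..<length I}. \<Sum>i | i \<in> {..<length I} \<and> p i = v. I ! i)"
    by (rule sum.image_gen) simp
  also have "\<dots> \<le> (\<Sum>v\<in>p ` {..<length I}. 1)"
    using assms by (intro sum_mono) (simp add: is_packing_def)
  finally show ?thesis
    by (simp add: bins_used_def)
qed

text \<open>The packing \<open>q\<close> guarantees that the \<open>LEAST\<close> in
  \<open>OPT\<close> is attained, so the volume bound applies to an optimal packing. It serves to
  make the optimum exceed any threshold.\<close>

lemma sum_list_le_OPT:
  assumes "is_packing I q"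
  shows "sum_list I \<le> real (OPT I)"
proof -
  have "\<exists>p. is_packing I p \<and> bins_used I p = OPT I"
    unfolding OPT_def by (rule LeastI_ex) (use assms in blast)
  then show ?thesis
    using sum_list_le_bins_used by metis
qed

text \<open>Some achieved ratio \<alpha> lies below \<beta>. Once the optimum is large, the
  sublinear term is absorbed by the gap \<open>(\<beta> - \<alpha>) * OPT I\<close>.\<close>

lemma asymptotic_ratio_lessD:
  assumes "asymptotic_ratio A < ereal \<beta>"
  obtains K where "\<And>I. item_sequence I \<Longrightarrow> K \<le> OPT I \<Longrightarrow>
    real (bins_used I (A I)) \<le> \<beta> * real (OPT I)"
proof -
  obtain \<alpha> where \<alpha>: "asymptotic_ratio_at_most A \<alpha>" "\<alpha> < \<beta>"
    using assms unfolding asymptotic_ratio_def Inf_less_iff by auto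
  then obtain f where f: "f \<in> o[OPT_at_top](\<lambda>I. real (OPT I))"
    and bound: "\<And>I. item_sequence I \<Longrightarrow> real (bins_used I (A I)) \<le> \<alpha> * real (OPT I) + f I"
    unfolding asymptotic_ratio_at_most_def by blast
  from landau_o.smallD[OF f, of "\<beta> - \<alpha>"] \<alpha>(2)
  have "\<forall>\<^sub>F I in OPT_at_top. \<bar>f I\<bar> \<le> (\<beta> - \<alpha>) * real (OPT I)"
    by simp
  then obtain K where K: "\<And>I. K \<le> OPT I \<Longrightarrow> item_sequence I \<Longrightarrow> \<bar>f I\<bar> \<le> (\<beta> - \<alpha>) * real (OPT I)"
    unfolding OPT_at_top_def eventually_inf_principal eventually_filtercomap_at_top_linorder
    by auto
  show thesis
  proof
    fix I assume I: "item_sequence I" "K \<le> OPT I"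
    show "real (bins_used I (A I)) \<le> \<beta> * real (OPT I)"
      using K[OF I(2,1)] bound[OF I(1)] by (simp add: algebra_simps)
  qed
qed

text \<open>Moving item \<open>i\<close> alone would already exceed the migration budget
  \<open>\<gamma> * x\<close> of an arriving item. Induction on the number of arrivals keeps it in
  place forever.\<close>

lemma large_items_not_moved:
  assumes mig: "has_migration_factor A \<gamma>"
    and "item_sequence I" "0 < x" "x \<le> 1"
    and large: "\<And>i. i < length I \<Longrightarrow> \<gamma> * x < I ! i"
    and "i < length I"
  shows "A (I @ replicate m x) i = A I i"
proof (induction m)
  case (Suc m)
  let ?J = "I @ replicate m x"
  have "A (?J @ [x]) i = A ?J i"
  proof (rule ccontr)
    assume moved: "A (?J @ [x]) i \<noteq> A ?J i"
    have seq: "item_sequence (?J @ [x])"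
      using assms by (auto simp: item_sequence_def)
    then have pos: "0 \<le> ?J ! j" if "j < length ?J" for j
      using nth_mem[OF that] by (auto simp: item_sequence_def)
    have "I ! i = (\<Sum>j\<in>{i}. ?J ! j)"
      using assms by (simp add: nth_append)
    also have "\<dots> \<le> (\<Sum>j | j < length ?J \<and> A (?J @ [x]) j \<noteq> A ?J j. ?J ! j)"
      using moved assms pos by (intro sum_mono2) auto
    also have "\<dots> \<le> \<gamma> * x"
      using mig seq unfolding has_migration_factor_def by blast
    finally show False
      using large[OF \<open>i < length I\<close>] by simp
  qed
  then show ?case
    using Suc by (simp add: replicate_append_same)
qed simp

text \<open>The fibre lies in a block of \<open>k\<close> consecutive positions. With
  \<open>N = 0\<close> and \<open>k = 2\<close> it describes pairs of big items, otherwise the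
  groups of small items.\<close>

lemma card_shifted_div_fibre_le:
  assumes "0 < k"
  shows "card {i::nat. N \<le> i \<and> i < L \<and> (i - N) div k = v} \<le> k"
proof -
  have "{i. N \<le> i \<and> i < L \<and> (i - N) div k = v} \<subseteq> {N + v * k..<N + v * k + k}"
  proof
    fix i assume "i \<in> {i. N \<le> i \<and> i < L \<and> (i - N) div k = v}"
    then have "N \<le> i" and v: "v = (i - N) div k"
      by auto
    then show "i \<in> {N + v * k..<N + v * k + k}"
      using div_mult_mod_eq[of "i - N" k] mod_less_divisor[OF assms, of "i - N"]
      unfolding v atLeastLessThan_iff by linarith
  qed
  from card_mono[OF _ this] show ?thesis
    by simp
qed

lemma OPT_big_items_le:
  assumes "0 \<le> b" "2 * b \<le> 1"
  shows "OPT (replicate (2 * M) b) \<le> M"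
proof -
  have "b * real (card {i. i < 2 * M \<and> i div 2 = v}) \<le> 1" for v
  proof -
    have "card {i. i < 2 * M \<and> i div 2 = v} \<le> 2"
      using card_shifted_div_fibre_le[of 2 0 "2 * M" v] by simp
    then have "b * real (card {i. i < 2 * M \<and> i div 2 = v}) \<le> b * 2"
      using assms by (intro mult_left_mono) auto
    with assms show ?thesis by simp
  qed
  then have "is_packing (replicate (2 * M) b) (\<lambda>i. i div 2)"
    using is_packing_two_sizes[of "2 * M" b 0 0 "\<lambda>i. i div 2"] by simp
  moreover have "bins_used (replicate (2 * M) b) (\<lambda>i. i div 2) \<le> card {..<M}"
    unfolding bins_used_def by (rule card_mono) auto
  ultimately show ?thesis
    using OPT_le_bins_used by fastforce
qed

text \<open>Bin \<open>v\<close> receives big item \<open>v\<close> and the \<open>v\<close>-th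
  block of \<open>k\<close> consecutive small items.\<close>

lemma OPT_big_small_items_le:
  assumes "0 \<le> b" "0 \<le> x" "b + x * real k \<le> 1" "0 < k"
  shows "OPT (replicate N b @ replicate (k * N) x) \<le> N"
proof -
  let ?p = "\<lambda>i. if i < N then i else (i - N) div k"
  let ?I = "replicate N b @ replicate (k * N) x"
  have "b * real (card {i. i < N \<and> ?p i = v}) +
        x * real (card {i. N \<le> i \<and> i < N + k * N \<and> ?p i = v}) \<le> 1" for v
  proof -
    have "card {i. i < N \<and> ?p i = v} \<le> card {v}"
      by (rule card_mono) auto
    then have "b * real (card {i. i < N \<and> ?p i = v}) \<le> b * 1"
      using assms by (intro mult_left_mono) auto
    moreover have "{i. N \<le> i \<and> i < N + k * N \<and> ?p i = v} =
      {i. N \<le> i \<and> i < N + k * N \<and> (i - N) div k = v}"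
      by auto
    then have "x * real (card {i. N \<le> i \<and> i < N + k * N \<and> ?p i = v}) \<le> x * real k"
      using assms card_shifted_div_fibre_le[OF \<open>0 < k\<close>, of N "N + k * N" v]
      by (intro mult_left_mono) auto
    ultimately show ?thesis
      using assms by linarith
  qed
  then have "is_packing ?I ?p"
    unfolding is_packing_two_sizes by blast
  moreover have "bins_used ?I ?p \<le> card {..<N}"
    unfolding bins_used_def
  proof (rule card_mono)
    show "?p ` {..<length ?I} \<subseteq> {..<N}"
      using \<open>0 < k\<close> by (auto simp: div_less_iff_less_mult mult.commute)
  qed simp
  ultimately show ?thesis
    using OPT_le_bins_used by fastforce
qed

text \<open>With \<open>P\<close> the bins holding two big items, the first phase gives
  \<open>N \<le> card V1 + card P\<close> and the weights give
  \<open>(2 * k + 1) * N + card P \<le> (2 * k + 1) * card V2\<close>. Adding them cancels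
  \<open>card P\<close>.\<close>

lemma bins_used_big_small_items_ge:
  fixes k N :: nat
  defines "I1 \<equiv> replicate N ((2 * real k + 1) / (4 * real k + 3))"
  defines "I2 \<equiv> I1 @ replicate ((k + 1) * N) (2 / (4 * real k + 3))"
  assumes "1 \<le> k" and pack: "is_packing I2 q" and same: "\<And>i. i < N \<Longrightarrow> q i = p i"
  shows "(2 * k + 1) * N + N \<le> (2 * k + 1) * bins_used I2 q + bins_used I1 p"
proof -
  define B where "B v = {i. i < N \<and> q i = v}" for v
  define S where "S v = {i. N \<le> i \<and> i < N + (k + 1) * N \<and> q i = v}" for v
  define V1 where "V1 = q ` {..<N}"
  define V2 where "V2 = q ` {..<N + (k + 1) * N}"
  define w where "w v = k * card (B v) + card (S v)" for v
  define P where "P = {v \<in> V1. 2 \<le> card (B v)}"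
  have sub: "V1 \<subseteq> V2" and fin: "finite V1" "finite V2"
    by (auto simp: V1_def V2_def)
  have bins1: "bins_used I1 p = card V1"
    using same by (auto simp: bins_used_def V1_def I1_def intro!: arg_cong[where f = card] image_cong)
  have bins2: "bins_used I2 q = card V2"
    by (simp add: bins_used_def V2_def I2_def I1_def)
  \<comment> \<open>Scaling by \<open>4 * k + 3\<close> turns the capacity into an inequality of
    naturals, so that later bounds can be rounded down.\<close>
  have cap: "(2 * k + 1) * card (B v) + 2 * card (S v) \<le> 4 * k + 3" for v
  proof -
    have "(2 * real k + 1) / (4 * real k + 3) * real (card (B v)) +
          2 / (4 * real k + 3) * real (card (S v)) \<le> 1"
      using pack unfolding I2_def I1_def is_packing_two_sizes B_def S_def by blast
    then have "((2 * real k + 1) * real (card (B v)) + 2 * real (card (S v))) / (4 * real k + 3) \<le> 1"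
      by (simp only: times_divide_eq_left add_divide_distrib[symmetric])
    then have "real ((2 * k + 1) * card (B v) + 2 * card (S v)) \<le> real (4 * k + 3)"
      by (simp add: field_simps)
    then show ?thesis
      using of_nat_le_iff by blast
  qed
  \<comment> \<open>Three big items would take \<open>6 * k + 3\<close> units, more than
    \<open>4 * k + 3\<close> because \<open>k\<close> is positive.\<close>
  have B_le: "card (B v) \<le> 2" for v
  proof (rule ccontr)
    assume "\<not> card (B v) \<le> 2"
    then have "(2 * k + 1) * 3 \<le> (2 * k + 1) * card (B v)"
      by (intro mult_le_mono2) simp
    also have "\<dots> \<le> 4 * k + 3"
      using cap[of v] by (rule add_leD1)
    finally show False
      using \<open>1 \<le> k\<close> by simp
  qed
  \<comment> \<open>By \<open>cap\<close>, \<open>2 * w v + card (B v) \<le> 4 * k + 3\<close>.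
    Halving and rounding down gives \<open>2 * k + 1\<close>, and \<open>2 * k\<close> for a
    pair.\<close>
  have w_le: "w v + (if 2 \<le> card (B v) then 1 else 0) \<le> 2 * k + 1" for v
    using cap[of v] by (auto simp: w_def algebra_simps)
  have sumB1: "(\<Sum>v\<in>V1. card (B v)) = N"
    using sum.image_gen[of "{..<N}" "\<lambda>_. 1::nat" q] by (simp add: V1_def B_def)
  have sumB: "(\<Sum>v\<in>V2. card (B v)) = N"
  proof -
    have "(\<Sum>v\<in>V1. card (B v)) = (\<Sum>v\<in>V2. card (B v))"
      by (rule sum.mono_neutral_left) (use sub fin in \<open>auto simp: V1_def B_def\<close>)
    with sumB1 show ?thesis by simp
  qed
  have sumBS: "(\<Sum>v\<in>V2. card (B v) + card (S v)) = N + (k + 1) * N"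
  proof -
    have "card (B v) + card (S v) = card {i. i < N + (k + 1) * N \<and> q i = v}" for v
    proof -
      have "{i. i < N + (k + 1) * N \<and> q i = v} = B v \<union> S v"
        by (auto simp: B_def S_def)
      moreover have "card (B v \<union> S v) = card (B v) + card (S v)"
        by (rule card_Un_disjoint) (auto simp: B_def S_def)
      ultimately show ?thesis by simp
    qed
    then show ?thesis
      using sum.image_gen[of "{..<N + (k + 1) * N}" "\<lambda>_. 1::nat" q] by (simp add: V2_def)
  qed
  \<comment> \<open>The big items contribute \<open>k * N\<close> and the small ones
    \<open>(k + 1) * N\<close>.\<close>
  have sumw: "(\<Sum>v\<in>V2. w v) = (2 * k + 1) * N"
    using sumB sumBS by (simp add: w_def sum.distrib sum_distrib_left[symmetric] algebra_simps)
  have "N \<le> (\<Sum>v\<in>V1. 1 + (if 2 \<le> card (B v) then 1 else 0))"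
    unfolding sumB1[symmetric]
  proof (rule sum_mono)
    show "card (B v) \<le> 1 + (if 2 \<le> card (B v) then 1 else 0)" for v
      using B_le[of v] by auto
  qed
  also have "\<dots> = card V1 + card P"
    using fin unfolding sum.distrib by (simp add: P_def sum.If_cases Int_def)
  finally have N_le: "N \<le> card V1 + card P" .
  have "(\<Sum>v\<in>V2. w v) + card P \<le> (\<Sum>v\<in>V2. w v + (if 2 \<le> card (B v) then 1 else 0))"
    using fin sub by (auto simp: sum.distrib P_def sum.If_cases Int_def intro!: card_mono)
  also have "\<dots> \<le> (\<Sum>v\<in>V2. 2 * k + 1)"
    by (rule sum_mono) (rule w_le)
  finally have "(2 * k + 1) * N + card P \<le> (2 * k + 1) * card V2"
    using sumw by (simp add: mult.commute)
  with N_le show ?thesis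
    unfolding bins1 bins2 by linarith
qed

theorem theorem1:
  fixes \<gamma> :: real and c :: int
  assumes "\<gamma> > 0" and "c = \<lceil>\<gamma>\<rceil>"
  shows "\<not> (\<exists>A. online_packing_algorithm A \<and> has_migration_factor A \<gamma> \<and>
                asymptotic_ratio A < ereal (1 + 1 / (6 * real_of_int c + 5)))"
proof
  assume "\<exists>A. online_packing_algorithm A \<and> has_migration_factor A \<gamma> \<and>
    asymptotic_ratio A < ereal (1 + 1 / (6 * real_of_int c + 5))"
  then obtain A where pack: "\<And>I. item_sequence I \<Longrightarrow> is_packing I (A I)"
    and mig: "has_migration_factor A \<gamma>"
    and ratio: "asymptotic_ratio A < ereal (1 + 1 / (6 * real_of_int c + 5))"
    unfolding online_packing_algorithm_def by blast
  define k where "k = nat c"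
  have "0 < c" using assms by simp
  then have k: "1 \<le> k" and c: "real_of_int c = real k"
    by (auto simp: k_def)
  have "\<gamma> \<le> real k"
    using assms c by (metis le_of_int_ceiling)
  define \<beta> where "\<beta> = 1 + 1 / (6 * real k + 5)"
  have "\<beta> \<ge> 0" by (simp add: \<beta>_def)
  obtain K where K: "\<And>I. item_sequence I \<Longrightarrow> K \<le> OPT I \<Longrightarrow>
    real (bins_used I (A I)) \<le> \<beta> * real (OPT I)"
    using asymptotic_ratio_lessD[OF ratio[unfolded c, folded \<beta>_def]] by blast
  define b where "b = (2 * real k + 1) / (4 * real k + 3)"
  define x where "x = 2 / (4 * real k + 3)"
  have sizes: "0 < b" "2 * b \<le> 1" "0 < x" "x \<le> 1" "b + x * real (k + 1) \<le> 1" "1 \<le> 3 * b" "real k * x < b"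
    using k by (auto simp: b_def x_def field_simps)
  then have "\<gamma> * x < b"
    using \<open>\<gamma> \<le> real k\<close> mult_right_mono[of \<gamma> "real k" x] by linarith
  \<comment> \<open>Since \<open>b\<close> is at least 1/3, the \<open>2 * M\<close> big items have
    volume at least \<open>K\<close>; the summand 1 keeps \<open>M\<close> positive for the final
    cancellation. The even number of big items allows a perfect pairing.\<close>
  define M where "M = 3 * K + 1"
  define I1 where "I1 = replicate (2 * M) b"
  define I2 where "I2 = I1 @ replicate ((k + 1) * (2 * M)) x"
  have seq: "item_sequence I1" "item_sequence I2"
    using sizes by (auto simp: item_sequence_def I1_def I2_def)
  have "real K \<le> sum_list I1"
  proof -
    have "real K \<le> real (2 * M) * (1 / 3)"
      by (simp add: M_def)
    also have "\<dots> \<le> real (2 * M) * b"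
      using sizes by (intro mult_left_mono) auto
    finally show ?thesis by (simp add: I1_def sum_list_replicate)
  qed
  moreover have "sum_list I1 \<le> sum_list I2"
    using sizes by (simp add: I2_def sum_list_replicate)
  ultimately have large: "K \<le> OPT I1" "K \<le> OPT I2"
    using sum_list_le_OPT[OF pack[OF seq(1)]] sum_list_le_OPT[OF pack[OF seq(2)]] by linarith+
  have "OPT I1 \<le> M"
    unfolding I1_def using sizes by (intro OPT_big_items_le) auto
  then have bins1: "real (bins_used I1 (A I1)) \<le> \<beta> * real M"
    using K[OF seq(1) large(1)] \<open>\<beta> \<ge> 0\<close> mult_left_mono[of "real (OPT I1)" "real M" \<beta>] by simp
  have "OPT I2 \<le> 2 * M"
    unfolding I2_def I1_def using sizes by (intro OPT_big_small_items_le) auto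
  then have bins2: "real (bins_used I2 (A I2)) \<le> \<beta> * real (2 * M)"
    using K[OF seq(2) large(2)] \<open>\<beta> \<ge> 0\<close> mult_left_mono[of "real (OPT I2)" "real (2 * M)" \<beta>] by linarith
  have "A I2 i = A I1 i" if "i < 2 * M" for i
    unfolding I2_def using that \<open>\<gamma> * x < b\<close> sizes
    by (intro large_items_not_moved[OF mig seq(1)]) (auto simp: I1_def)
  then have "(2 * k + 1) * (2 * M) + 2 * M \<le> (2 * k + 1) * bins_used I2 (A I2) + bins_used I1 (A I1)"
    using pack[OF seq(2)] k unfolding I2_def I1_def b_def x_def
    by (intro bins_used_big_small_items_ge) auto
  then have "real ((2 * k + 1) * (2 * M) + 2 * M) \<le>
    real ((2 * k + 1) * bins_used I2 (A I2) + bins_used I1 (A I1))"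
    using of_nat_le_iff by blast
  then have "(2 * real k + 2) * (2 * real M) \<le>
    (2 * real k + 1) * real (bins_used I2 (A I2)) + real (bins_used I1 (A I1))"
    by (simp add: algebra_simps)
  also have "\<dots> \<le> (2 * real k + 1) * (\<beta> * real (2 * M)) + \<beta> * real M"
    using bins1 bins2 by (intro add_mono mult_left_mono) auto
  also have "\<dots> = (4 * real k + 3) * \<beta> * real M"
    by (simp add: algebra_simps)
  finally have "(4 * real k + 4) * real M \<le> ((4 * real k + 3) * \<beta>) * real M"
    by (simp add: algebra_simps)
  \<comment> \<open>Cancelling \<open>M\<close> leaves \<beta> at least
    \<open>1 + 1 / (4 * k + 3)\<close>, which exceeds \<open>1 + 1 / (6 * k + 5)\<close>.\<close>
  then have "4 * real k + 4 \<le> (4 * real k + 3) * \<beta>"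
    by (rule mult_right_le_imp_le) (simp add: M_def)
  then show False
    by (simp add: \<beta>_def field_simps)
qed

end
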